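(* Let $\mathcal C=\mathbb R^3\times\mathbb S^2$ with points $(\vec r,\vec n)$, let $\omega^0=\vec n\cdot\mathrm d\vec r$, $\mathcal D=\ker\omega^0$, and let $g=(\mathrm d\vec r\cdot\mathrm d\vec n)|_{\mathcal D}$ (symmetric product). Then $g$ is a metric of split signature $(+,+,-,-)$ on $\mathcal D$ whose conformal class $[g]$ is compatible with the contact structure of $\mathcal D$, so that $(\mathcal C,[\omega^0],[g])$ is a 5-dimensional Legendrean contact structure. Moreover, a curve $(\vec r(t),\vec n(t))$ in $\mathcal C$ is an attacking mode man\oe uvre if and only if it is tangent to $\mathcal D$ and null with respect to $[g]$.
   Context: $\mathcal C=\mathbb R^3\times\mathbb S^2$ is the configuration space of a "flying saucer" (disc with centre $\vec r\in\mathbb R^3$ and unit normal $\vec n\in\mathbb S^2$). All saucer motions are required to satisfy $\vec n\cdot\dot{\vec r}=0$. An attacking mode man\oe uvre is a curve $(\vec r(t),\vec n(t))$ satisfying this constraint and such that at every time $\dot{\vec r}(t)$ is parallel to $\vec n(t)\times\dot{\vec n}(t)$, meaning $\dot{\vec r}\times(\vec n\times\dot{\vec n})=0$. A Legendrean contact structure on a $(2n+1)$-dimensional manifold $M$ is a contact distribution $\mathcal D=\ker\omega^0$ together with a splitting $\mathcal D=\mathcal D^+\oplus\mathcal D^-$ into rank $n$ subbundles on each of which $\Omega=(\mathrm d\omega^0)|_{\mathcal D}$ vanishes identically. A conformal class $[g]$ of split signature metrics on $\mathcal D$ is called compatible with the contact structure if there exist $g'\in[g]$ and $\Omega'$ in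 the conformal class of $\Omega=(\mathrm d\omega^0)|_{\mathcal D}$ such that the endomorphism $K$ of $\mathcal D$ given by $K^i{}_j=g'^{ik}\Omega'_{kj}$ satisfies $K^2=\mathrm{Id}$ and its $+1$ and $-1$ eigenspaces have the same dimension; the associated Legendrean contact structure, denoted $(M,[\omega^0],[g])$, is given by the $\pm1$ eigenspaces $\mathcal D^\pm$ of $K$. A curve tangent to $\mathcal D$ is null if $g(\dot\gamma,\dot\gamma)=0$ at all times. *)

theory Defs
  imports "HOL-Analysis.Analysis"
begin

section \<open>Smooth maps and embedded submanifolds of Euclidean space\<close>

text \<open>
  \<open>Ck_on k S f\<close> is meant for open \<open>S\<close>: all iterated directional derivatives of \<open>f\<close> of order
  at most \<open>k\<close> exist (the lower ones as total derivatives) and are continuous on \<open>S\<close>.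
\<close>

primrec Ck_on :: "nat \<Rightarrow> 'a::euclidean_space set \<Rightarrow> ('a \<Rightarrow> 'b::real_normed_vector) \<Rightarrow> bool" where
  "Ck_on 0 S f \<longleftrightarrow> continuous_on S f"
| "Ck_on (Suc k) S f \<longleftrightarrow>
     (\<forall>x\<in>S. f differentiable (at x)) \<and>
     (\<forall>v. Ck_on k S (\<lambda>x. frechet_derivative f (at x) v))"

definition smooth_on :: "'a::euclidean_space set \<Rightarrow> ('a \<Rightarrow> 'b::real_normed_vector) \<Rightarrow> bool" where
  "smooth_on S f \<longleftrightarrow> (\<forall>k. Ck_on k S f)"

text \<open>Smoothness on an arbitrary subset: local extendability to smooth maps on open sets.\<close>

definition smooth_map :: "'a::euclidean_space set \<Rightarrow> ('a \<Rightarrow> 'b::real_normed_vector) \<Rightarrow> bool" where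
  "smooth_map M f \<longleftrightarrow>
     (\<forall>p\<in>M. \<exists>U F. open U \<and> p \<in> U \<and> smooth_on U F \<and> (\<forall>q\<in>M \<inter> U. F q = f q))"

definition embedded_submanifold :: "nat \<Rightarrow> 'a::euclidean_space set \<Rightarrow> bool" where
  "embedded_submanifold k M \<longleftrightarrow>
     (\<forall>p\<in>M. \<exists>U V \<phi> \<psi> L.
        open U \<and> p \<in> U \<and> open (V :: 'a set) \<and>
        homeomorphism U V \<phi> \<psi> \<and> smooth_on U \<phi> \<and> smooth_on V \<psi> \<and>
        subspace L \<and> dim L = k \<and> \<phi> ` (U \<inter> M) = V \<inter> L)"

definition tangent_space :: "'a::euclidean_space set \<Rightarrow> 'a \<Rightarrow> 'a set" where
  "tangent_space M p =
     {v. \<exists>\<gamma> e. e > 0 \<and> smooth_on {-e<..<e} \<gamma> \<and> \<gamma> ` {-e<..<e} \<subseteq> M \<and> \<gamma> 0 = p \<and>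
           (\<gamma> has_vector_derivative v) (at (0::real))}"

definition smooth_subbundle :: "nat \<Rightarrow> 'a::euclidean_space set \<Rightarrow> ('a \<Rightarrow> 'a set) \<Rightarrow> bool" where
  "smooth_subbundle k M E \<longleftrightarrow>
     (\<forall>p\<in>M. subspace (E p) \<and> E p \<subseteq> tangent_space M p \<and> dim (E p) = k) \<and>
     (\<forall>p\<in>M. \<exists>U X. open U \<and> p \<in> U \<and>
        (\<forall>i<k. smooth_map (M \<inter> U) (X i)) \<and>
        (\<forall>q\<in>M \<inter> U. E q = span ((\<lambda>i. X i q) ` {..<k})))"


section \<open>Contact forms\<close>

text \<open>
  A one-form on \<open>M\<close> is given by a one-form \<open>\<omega> p :: 'a \<Rightarrow> real\<close> on an open neighbourhood of \<open>M\<close>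
  in the ambient space.  Its exterior derivative, without a factor 1/2, is taken in the ambient
  space; since pull-back commutes with the exterior derivative, its restriction to tangent vectors
  of \<open>M\<close> is the exterior derivative of the form induced on \<open>M\<close>.
\<close>

definition smooth_one_form :: "'a::euclidean_space set \<Rightarrow> ('a \<Rightarrow> 'a \<Rightarrow> real) \<Rightarrow> bool" where
  "smooth_one_form M \<omega> \<longleftrightarrow>
     (\<exists>W. open W \<and> M \<subseteq> W \<and> (\<forall>p\<in>W. linear (\<omega> p)) \<and> (\<forall>v. smooth_on W (\<lambda>p. \<omega> p v)))"

definition ext_deriv :: "('a::euclidean_space \<Rightarrow> 'a \<Rightarrow> real) \<Rightarrow> 'a \<Rightarrow> 'a \<Rightarrow> 'a \<Rightarrow> real" where
  "ext_deriv \<omega> p X Y =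
     frechet_derivative (\<lambda>q. \<omega> q Y) (at p) X - frechet_derivative (\<lambda>q. \<omega> q X) (at p) Y"

definition ker_dist :: "'a::euclidean_space set \<Rightarrow> ('a \<Rightarrow> 'a \<Rightarrow> real) \<Rightarrow> 'a \<Rightarrow> 'a set" where
  "ker_dist M \<omega> p = {X \<in> tangent_space M p. \<omega> p X = 0}"

definition contact_form :: "nat \<Rightarrow> 'a::euclidean_space set \<Rightarrow> ('a \<Rightarrow> 'a \<Rightarrow> real) \<Rightarrow> bool" where
  "contact_form n M \<omega> \<longleftrightarrow>
     embedded_submanifold (2 * n + 1) M \<and> smooth_one_form M \<omega> \<and>
     (\<forall>p\<in>M. (\<exists>X\<in>tangent_space M p. \<omega> p X \<noteq> 0) \<and>
        (\<forall>X\<in>ker_dist M \<omega> p. (\<forall>Y\<in>ker_dist M \<omega> p. ext_deriv \<omega> p X Y = 0) \<longrightarrow> X = 0))"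

definition legendrean_contact_structure ::
  "nat \<Rightarrow> 'a::euclidean_space set \<Rightarrow> ('a \<Rightarrow> 'a \<Rightarrow> real) \<Rightarrow> ('a \<Rightarrow> 'a set) \<Rightarrow> ('a \<Rightarrow> 'a set) \<Rightarrow> bool"
where
  "legendrean_contact_structure n M \<omega> Dp Dm \<longleftrightarrow>
     contact_form n M \<omega> \<and> smooth_subbundle n M Dp \<and> smooth_subbundle n M Dm \<and>
     (\<forall>p\<in>M.
        ker_dist M \<omega> p = {X + Y | X Y. X \<in> Dp p \<and> Y \<in> Dm p} \<and> Dp p \<inter> Dm p = {0} \<and>
        (\<forall>X\<in>Dp p. \<forall>Y\<in>Dp p. ext_deriv \<omega> p X Y = 0) \<and>
        (\<forall>X\<in>Dm p. \<forall>Y\<in>Dm p. ext_deriv \<omega> p X Y = 0))"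


section \<open>Metrics on distributions and compatibility\<close>

text \<open>Only the values of a bilinear form \<open>g p\<close> on the fibre \<open>D p\<close> are ever relevant.\<close>

definition linear_within :: "'a::real_vector set \<Rightarrow> ('a \<Rightarrow> 'b::real_vector) \<Rightarrow> bool" where
  "linear_within V f \<longleftrightarrow>
     (\<forall>X\<in>V. \<forall>Y\<in>V. \<forall>a b. f (a *\<^sub>R X + b *\<^sub>R Y) = a *\<^sub>R f X + b *\<^sub>R f Y)"

definition has_signature ::
  "'a::euclidean_space set \<Rightarrow> ('a \<Rightarrow> 'a \<Rightarrow> real) \<Rightarrow> nat \<Rightarrow> nat \<Rightarrow> bool" where
  "has_signature V b r s \<longleftrightarrow>
     (\<exists>P N. subspace P \<and> subspace N \<and> dim P = r \<and> dim N = s \<and>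
        V = {X + Y | X Y. X \<in> P \<and> Y \<in> N} \<and>
        (\<forall>X\<in>P. \<forall>Y\<in>N. b X Y = 0) \<and>
        (\<forall>X\<in>P. X \<noteq> 0 \<longrightarrow> b X X > 0) \<and> (\<forall>Y\<in>N. Y \<noteq> 0 \<longrightarrow> b Y Y < 0))"

definition metric_of_signature ::
  "'a::euclidean_space set \<Rightarrow> ('a \<Rightarrow> 'a set) \<Rightarrow> ('a \<Rightarrow> 'a \<Rightarrow> 'a \<Rightarrow> real) \<Rightarrow> nat \<Rightarrow> nat \<Rightarrow> bool" where
  "metric_of_signature M D g r s \<longleftrightarrow>
     (\<forall>p\<in>M. (\<forall>X\<in>D p. linear_within (D p) (g p X)) \<and>
        (\<forall>X\<in>D p. \<forall>Y\<in>D p. g p X Y = g p Y X) \<and>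
        has_signature (D p) (g p) r s) \<and>
     (\<forall>U X Y. open U \<and> smooth_map (M \<inter> U) X \<and> smooth_map (M \<inter> U) Y \<and>
        (\<forall>p\<in>M \<inter> U. X p \<in> D p \<and> Y p \<in> D p) \<longrightarrow>
        smooth_map (M \<inter> U) (\<lambda>p. g p (X p) (Y p)))"

definition conformal_metrics ::
  "'a::euclidean_space set \<Rightarrow> ('a \<Rightarrow> 'a set) \<Rightarrow> ('a \<Rightarrow> 'a \<Rightarrow> 'a \<Rightarrow> real) \<Rightarrow> ('a \<Rightarrow> 'a \<Rightarrow> 'a \<Rightarrow> real) set"
where
  "conformal_metrics M D g =
     {g'. \<exists>f. smooth_map M f \<and> (\<forall>p\<in>M. f p > 0) \<and>
            (\<forall>p\<in>M. \<forall>X\<in>D p. \<forall>Y\<in>D p. g' p X Y = f p * g p X Y)}"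

text \<open>
  A contact distribution determines \<open>\<omega>\<close>, and hence \<open>d\<omega>\<close> on its kernel, up to a nowhere vanishing
  function, of either sign.
\<close>

definition conformal_two_forms ::
  "'a::euclidean_space set \<Rightarrow> ('a \<Rightarrow> 'a set) \<Rightarrow> ('a \<Rightarrow> 'a \<Rightarrow> 'a \<Rightarrow> real) \<Rightarrow> ('a \<Rightarrow> 'a \<Rightarrow> 'a \<Rightarrow> real) set"
where
  "conformal_two_forms M D \<Omega> =
     {\<Omega>'. \<exists>f. smooth_map M f \<and> (\<forall>p\<in>M. f p \<noteq> 0) \<and>
            (\<forall>p\<in>M. \<forall>X\<in>D p. \<forall>Y\<in>D p. \<Omega>' p X Y = f p * \<Omega> p X Y)}"

definition eigenspace_in :: "'a::real_vector set \<Rightarrow> ('a \<Rightarrow> 'a) \<Rightarrow> real \<Rightarrow> 'a set" where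
  "eigenspace_in V K c = {X \<in> V. K X = c *\<^sub>R X}"

text \<open>
  The equation \<open>g' p X (K p Y) = \<Omega>' p X Y\<close> is the index formula
  $g'_{ik} K^k{}_j = \Omega'_{ij}$, that is, $K^i{}_j = g'^{ik} \Omega'_{kj}$.
\<close>

definition compatible_endomorphism ::
  "'a::euclidean_space set \<Rightarrow> ('a \<Rightarrow> 'a \<Rightarrow> real) \<Rightarrow> ('a \<Rightarrow> 'a \<Rightarrow> 'a \<Rightarrow> real) \<Rightarrow> ('a \<Rightarrow> 'a \<Rightarrow> 'a) \<Rightarrow> bool"
where
  "compatible_endomorphism M \<omega> g K \<longleftrightarrow>
     (\<exists>g' \<in> conformal_metrics M (ker_dist M \<omega>) g.
      \<exists>\<Omega>' \<in> conformal_two_forms M (ker_dist M \<omega>) (ext_deriv \<omega>).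
      \<forall>p\<in>M. let D = ker_dist M \<omega> p in
        K p ` D \<subseteq> D \<and> linear_within D (K p) \<and>
        (\<forall>X\<in>D. \<forall>Y\<in>D. g' p X (K p Y) = \<Omega>' p X Y) \<and>
        (\<forall>X\<in>D. K p (K p X) = X) \<and>
        dim (eigenspace_in D (K p) 1) = dim (eigenspace_in D (K p) (-1)))"

definition compatible ::
  "'a::euclidean_space set \<Rightarrow> ('a \<Rightarrow> 'a \<Rightarrow> real) \<Rightarrow> ('a \<Rightarrow> 'a \<Rightarrow> 'a \<Rightarrow> real) \<Rightarrow> bool" where
  "compatible M \<omega> g \<longleftrightarrow> (\<exists>K. compatible_endomorphism M \<omega> g K)"

text \<open>
  The triple $(M,[\omega],[g])$ is a Legendrean contact structure.  The endomorphism is unique only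
  up to sign, which swaps the two eigenspaces; hence the quantification over all of them.
\<close>

definition legendrean_contact_metric_structure ::
  "nat \<Rightarrow> 'a::euclidean_space set \<Rightarrow> ('a \<Rightarrow> 'a \<Rightarrow> real) \<Rightarrow> ('a \<Rightarrow> 'a \<Rightarrow> 'a \<Rightarrow> real) \<Rightarrow> bool" where
  "legendrean_contact_metric_structure n M \<omega> g \<longleftrightarrow>
     contact_form n M \<omega> \<and> metric_of_signature M (ker_dist M \<omega>) g n n \<and> compatible M \<omega> g \<and>
     (\<forall>K. compatible_endomorphism M \<omega> g K \<longrightarrow>
        legendrean_contact_structure n M \<omega>
          (\<lambda>p. eigenspace_in (ker_dist M \<omega> p) (K p) 1)
          (\<lambda>p. eigenspace_in (ker_dist M \<omega> p) (K p) (-1)))"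


section \<open>Curves\<close>

text \<open>
  Curves are differentiable and parametrised by an arbitrary nondegenerate interval, with one-sided
  derivatives at endpoints belonging to it.
\<close>

definition curve_in :: "'a::euclidean_space set \<Rightarrow> real set \<Rightarrow> (real \<Rightarrow> 'a) \<Rightarrow> bool" where
  "curve_in M I \<gamma> \<longleftrightarrow>
     is_interval I \<and> (\<exists>a\<in>I. \<exists>b\<in>I. a < b) \<and> \<gamma> differentiable_on I \<and> \<gamma> ` I \<subseteq> M"

definition velocity :: "real set \<Rightarrow> (real \<Rightarrow> 'a::real_normed_vector) \<Rightarrow> real \<Rightarrow> 'a" where
  "velocity I \<gamma> t = vector_derivative \<gamma> (at t within I)"

definition tangent_to :: "('a::euclidean_space \<Rightarrow> 'a set) \<Rightarrow> real set \<Rightarrow> (real \<Rightarrow> 'a) \<Rightarrow> bool" where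
  "tangent_to D I \<gamma> \<longleftrightarrow> (\<forall>t\<in>I. velocity I \<gamma> t \<in> D (\<gamma> t))"

definition null_curve ::
  "'a::euclidean_space set \<Rightarrow> ('a \<Rightarrow> 'a set) \<Rightarrow> ('a \<Rightarrow> 'a \<Rightarrow> 'a \<Rightarrow> real) \<Rightarrow> real set \<Rightarrow> (real \<Rightarrow> 'a) \<Rightarrow> bool"
where
  "null_curve M D g I \<gamma> \<longleftrightarrow>
     (\<forall>g'\<in>conformal_metrics M D g. \<forall>t\<in>I. g' (\<gamma> t) (velocity I \<gamma> t) (velocity I \<gamma> t) = 0)"


section \<open>The flying saucer\<close>

definition saucer_space :: "((real^3) \<times> (real^3)) set" where
  "saucer_space = UNIV \<times> sphere 0 1"

definition saucer_form :: "(real^3) \<times> (real^3) \<Rightarrow> (real^3) \<times> (real^3) \<Rightarrow> real" where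
  "saucer_form p X = snd p \<bullet> fst X"

text \<open>The symmetric product is $\alpha\beta = (\alpha\otimes\beta + \beta\otimes\alpha)/2$.\<close>

definition saucer_metric :: "(real^3) \<times> (real^3) \<Rightarrow> (real^3) \<times> (real^3) \<Rightarrow> (real^3) \<times> (real^3) \<Rightarrow> real" where
  "saucer_metric p X Y = (fst X \<bullet> snd Y + fst Y \<bullet> snd X) / 2"

definition attacking_mode :: "real set \<Rightarrow> (real \<Rightarrow> real^3) \<Rightarrow> (real \<Rightarrow> real^3) \<Rightarrow> bool" where
  "attacking_mode I r n \<longleftrightarrow>
     (\<forall>t\<in>I. n t \<bullet> velocity I r t = 0 \<and>
        cross3 (velocity I r t) (cross3 (n t) (velocity I n t)) = 0)"

end

theory Submission
  imports Defs
begin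

text \<open>
  The fibre of the contact distribution at \<open>(r, n)\<close> consists of the \<open>(v, w)\<close> with \<open>v, w\<close> both
  orthogonal to \<open>n\<close>.  On it \<open>g\<close> has the quadratic form \<open>v \<bullet> w\<close>, with the diagonal positive and the
  antidiagonal negative definite, and \<open>d\<omega>\<close> pairs the two factors antisymmetrically; hence a
  compatible endomorphism is \<open>\<sigma> (v, -w)\<close> for a sign \<open>\<sigma>\<close>, which is continuous and so locally constant.
  Its eigenbundles are therefore locally the two coordinate factors, framed by \<open>n \<times> a\<close> and
  \<open>n \<times> b\<close>.  For \<open>v\<close> orthogonal to \<open>n\<close>, the Lagrange identity gives \<open>v \<times> (n \<times> w) = (v \<bullet> w) n\<close>, so
  being parallel means being null.
\<close>

section \<open>Calculus of \<open>C\<^sup>k\<close> maps\<close>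

text \<open>On an open set a derivative at \<open>x\<close> only sees values near \<open>x\<close>,
  so \<open>f\<close> and \<open>g\<close> share their derivatives and the induction passes to
  these.\<close>

lemma Ck_on_cong:
  assumes "open S" "\<And>x. x \<in> S \<Longrightarrow> f x = g x" "Ck_on k S f"
  shows "Ck_on k S g"
  using assms(2,3)
proof (induction k arbitrary: f g)
  case 0
  then show ?case by (metis Ck_on.simps(1) continuous_on_eq)
next
  case (Suc k)
  have d: "(g has_derivative frechet_derivative f (at x)) (at x)" if "x \<in> S" for x
  proof -
    have "(f has_derivative frechet_derivative f (at x)) (at x)"
      using Suc.prems(2) that by (intro frechet_derivative_works[THEN iffD1]) simp
    then show ?thesis
      using has_derivative_transform_within_open[OF _ \<open>open S\<close> that] Suc.prems(1) by blast
  qed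
  then have e: "frechet_derivative g (at x) = frechet_derivative f (at x)" if "x \<in> S" for x
    using frechet_derivative_at[OF d[OF that]] by simp
  have "Ck_on k S (\<lambda>x. frechet_derivative g (at x) v)" for v
  proof (rule Suc.IH)
    show "Ck_on k S (\<lambda>x. frechet_derivative f (at x) v)"
      using Suc.prems(2) by simp
  qed (simp add: e)
  then show ?case
    using d by (auto simp: differentiable_def)
qed

text \<open>Uniqueness of derivatives allows any explicit derivative \<open>f'\<close> in place of
  the choice term \<open>frechet_derivative\<close>.\<close>

lemma Ck_on_SucI:
  assumes "open S" and d: "\<And>x. x \<in> S \<Longrightarrow> (f has_derivative f' x) (at x)"
    and "\<And>v. Ck_on k S (\<lambda>x. f' x v)"
  shows "Ck_on (Suc k) S f"
proof -
  have "Ck_on k S (\<lambda>x. frechet_derivative f (at x) v)" for v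
  proof (rule Ck_on_cong[OF \<open>open S\<close> _ assms(3)])
    show "f' x v = frechet_derivative f (at x) v" if "x \<in> S" for x
      using frechet_derivative_at[OF d[OF that]] by simp
  qed
  then show ?thesis
    using d by (auto simp: differentiable_def)
qed

lemma Ck_on_Suc_has_derivative:
  "Ck_on (Suc k) S f \<Longrightarrow> x \<in> S \<Longrightarrow> (f has_derivative frechet_derivative f (at x)) (at x)"
  by (intro frechet_derivative_works[THEN iffD1]) simp

lemma Ck_on_SucD: "Ck_on (Suc k) S f \<Longrightarrow> Ck_on k S f"
proof (induction k arbitrary: f)
  case 0
  then show ?case
    by (auto intro!: differentiable_imp_continuous_on differentiable_at_imp_differentiable_on)
next
  case (Suc k)
  have "Ck_on k S (\<lambda>x. frechet_derivative f (at x) v)" for v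
    using Suc.prems Suc.IH Ck_on.simps(2) by blast
  then show ?case
    using Suc.prems Ck_on.simps(2) by blast
qed

lemma Ck_on_subset: "Ck_on k S f \<Longrightarrow> T \<subseteq> S \<Longrightarrow> Ck_on k T f"
  by (induction k arbitrary: f) (auto intro: continuous_on_subset)

lemma Ck_on_const: "open S \<Longrightarrow> Ck_on k S (\<lambda>x. c)"
proof (induction k arbitrary: c)
  case (Suc k)
  show ?case
    by (rule Ck_on_SucI[where f' = "\<lambda>x v. 0"]) (auto simp: Suc)
qed simp

lemma Ck_on_bounded_linear:
  assumes L: "bounded_linear L" and "open S" "Ck_on k S f"
  shows "Ck_on k S (\<lambda>x. L (f x))"
  using assms(3)
proof (induction k arbitrary: f)
  case 0
  then show ?case
    using bounded_linear.continuous_on[OF L] by simp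
next
  case (Suc k)
  show ?case
  proof (rule Ck_on_SucI[OF \<open>open S\<close>])
    show "((\<lambda>x. L (f x)) has_derivative (\<lambda>v. L (frechet_derivative f (at x) v))) (at x)"
      if "x \<in> S" for x
      by (rule bounded_linear.has_derivative[OF L Ck_on_Suc_has_derivative[OF Suc.prems that]])
    show "Ck_on k S (\<lambda>x. L (frechet_derivative f (at x) v))" for v
      using Suc by simp
  qed
qed

lemma Ck_on_ident: "open S \<Longrightarrow> Ck_on k S (\<lambda>x. x)"
proof (induction k)
  case (Suc k)
  show ?case
    by (rule Ck_on_SucI[where f' = "\<lambda>x v. v"]) (auto simp: Suc Ck_on_const)
qed simp

lemma Ck_on_add:
  assumes "open S" "Ck_on k S f" "Ck_on k S g"
  shows "Ck_on k S (\<lambda>x. f x + g x)"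
  using assms(2,3)
proof (induction k arbitrary: f g)
  case 0
  then show ?case by (simp add: continuous_on_add)
next
  case (Suc k)
  show ?case
  proof (rule Ck_on_SucI[OF \<open>open S\<close>])
    show "((\<lambda>x. f x + g x) has_derivative
        (\<lambda>v. frechet_derivative f (at x) v + frechet_derivative g (at x) v)) (at x)"
      if "x \<in> S" for x
      using Suc.prems that by (intro has_derivative_add Ck_on_Suc_has_derivative)
    show "Ck_on k S (\<lambda>x. frechet_derivative f (at x) v + frechet_derivative g (at x) v)" for v
      using Suc by simp
  qed
qed

text \<open>Product rule: each summand of the derivative keeps one undifferentiated factor, which
  \<open>Ck_on_SucD\<close> lowers to order \<open>k\<close>. Products, scalings and inner products
  are instances.\<close>

lemma Ck_on_bounded_bilinear:
  assumes B: "bounded_bilinear B" and "open S" "Ck_on k S f" "Ck_on k S g"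
  shows "Ck_on k S (\<lambda>x. B (f x) (g x))"
  using assms(3,4)
proof (induction k arbitrary: f g)
  case 0
  then show ?case
    using bounded_bilinear.continuous_on[OF B] by simp
next
  case (Suc k)
  show ?case
  proof (rule Ck_on_SucI[OF \<open>open S\<close>])
    show "((\<lambda>x. B (f x) (g x)) has_derivative
        (\<lambda>v. B (f x) (frechet_derivative g (at x) v) + B (frechet_derivative f (at x) v) (g x)))
        (at x)"
      if "x \<in> S" for x
      using Suc.prems that
      by (intro bounded_bilinear.FDERIV[OF B] Ck_on_Suc_has_derivative)
    show "Ck_on k S
        (\<lambda>x. B (f x) (frechet_derivative g (at x) v) + B (frechet_derivative f (at x) v) (g x))" for v
      using Suc.prems Ck_on_SucD[OF Suc.prems(1)] Ck_on_SucD[OF Suc.prems(2)]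
      by (intro Ck_on_add \<open>open S\<close> Suc.IH) auto
  qed
qed

text \<open>The derivative of \<open>1 / f\<close> is built from \<open>1 / f\<close> itself and the
  derivative of \<open>f\<close>, so the induction stays with one fixed \<open>f\<close>.\<close>

lemma Ck_on_inverse:
  fixes f :: "'a::euclidean_space \<Rightarrow> real"
  assumes "open S" and nz: "\<And>x. x \<in> S \<Longrightarrow> f x \<noteq> 0" and "Ck_on k S f"
  shows "Ck_on k S (\<lambda>x. inverse (f x))"
  using assms(3)
proof (induction k)
  case 0
  then show ?case
    using nz by (auto intro: continuous_on_inverse)
next
  case (Suc k)
  note mult = Ck_on_bounded_bilinear[OF bounded_bilinear_mult \<open>open S\<close>]
  show ?case
  proof (rule Ck_on_SucI[OF \<open>open S\<close>])
    show "((\<lambda>x. inverse (f x)) has_derivative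
        (\<lambda>v. - (inverse (f x) * frechet_derivative f (at x) v * inverse (f x)))) (at x)"
      if "x \<in> S" for x
      using Suc.prems that nz
      by (intro Deriv.has_derivative_inverse Ck_on_Suc_has_derivative) auto
    show "Ck_on k S (\<lambda>x. - (inverse (f x) * frechet_derivative f (at x) v * inverse (f x)))" for v
      using Suc.IH[OF Ck_on_SucD[OF Suc.prems]] Suc.prems
      by (intro Ck_on_bounded_linear[OF bounded_linear_minus[OF bounded_linear_ident]]
          mult \<open>open S\<close>) auto
  qed
qed

section \<open>Closure properties of smooth maps on open sets\<close>

lemma smooth_on_subset: "smooth_on S f \<Longrightarrow> T \<subseteq> S \<Longrightarrow> smooth_on T f"
  by (auto simp: smooth_on_def intro: Ck_on_subset)

lemma smooth_on_const: "open S \<Longrightarrow> smooth_on S (\<lambda>x. c)"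
  by (simp add: smooth_on_def Ck_on_const)

lemma smooth_on_ident: "open S \<Longrightarrow> smooth_on S (\<lambda>x. x)"
  by (simp add: smooth_on_def Ck_on_ident)

lemma smooth_on_linear:
  fixes L :: "'b::euclidean_space \<Rightarrow> 'c::real_normed_vector"
  shows "linear L \<Longrightarrow> open S \<Longrightarrow> smooth_on S f \<Longrightarrow> smooth_on S (\<lambda>x. L (f x))"
  by (simp add: smooth_on_def Ck_on_bounded_linear linear_conv_bounded_linear)

lemma smooth_on_add:
  "open S \<Longrightarrow> smooth_on S f \<Longrightarrow> smooth_on S g \<Longrightarrow> smooth_on S (\<lambda>x. f x + g x)"
  by (simp add: smooth_on_def Ck_on_add)

lemma smooth_on_bilinear:
  fixes B :: "'b::euclidean_space \<Rightarrow> 'c::euclidean_space \<Rightarrow> 'd::real_normed_vector"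
  assumes "bilinear B" "open S" "smooth_on S f" "smooth_on S g"
  shows "smooth_on S (\<lambda>x. B (f x) (g x))"
  using assms by (simp add: smooth_on_def Ck_on_bounded_bilinear bilinear_conv_bounded_bilinear)

lemma smooth_on_inverse:
  fixes f :: "'a::euclidean_space \<Rightarrow> real"
  shows "open S \<Longrightarrow> (\<And>x. x \<in> S \<Longrightarrow> f x \<noteq> 0) \<Longrightarrow> smooth_on S f \<Longrightarrow> smooth_on S (\<lambda>x. inverse (f x))"
  by (simp add: smooth_on_def Ck_on_inverse)

lemma smooth_on_scaleR:
  fixes g :: "'a::euclidean_space \<Rightarrow> 'b::euclidean_space"
  shows "open S \<Longrightarrow> smooth_on S f \<Longrightarrow> smooth_on S g \<Longrightarrow> smooth_on S (\<lambda>x. f x *\<^sub>R g x)"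
  by (simp add: smooth_on_def Ck_on_bounded_bilinear[OF bounded_bilinear_scaleR])

lemma smooth_on_inner:
  fixes f g :: "'a::euclidean_space \<Rightarrow> 'b::euclidean_space"
  shows "open S \<Longrightarrow> smooth_on S f \<Longrightarrow> smooth_on S g \<Longrightarrow> smooth_on S (\<lambda>x. f x \<bullet> g x)"
  by (simp add: smooth_on_def Ck_on_bounded_bilinear[OF bounded_bilinear_inner])

lemma smooth_on_Pair:
  fixes f :: "'a::euclidean_space \<Rightarrow> 'b::euclidean_space"
    and g :: "'a \<Rightarrow> 'c::euclidean_space"
  assumes "open S" "smooth_on S f" "smooth_on S g"
  shows "smooth_on S (\<lambda>x. (f x, g x))"
proof -
  \<comment> \<open>A pair is the sum of the images of its components under the coordinate
    inclusions, so linear maps and addition suffice.\<close>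
  have "smooth_on S (\<lambda>x. (f x, 0) + (0, g x))"
    using assms
    by (intro smooth_on_add smooth_on_linear[where L = "\<lambda>y. (y, 0)"]
        smooth_on_linear[where L = "\<lambda>y. (0, y)"])
      (auto intro!: linearI)
  then show ?thesis
    by simp
qed

section \<open>Smoothness on arbitrary subsets and locality of subbundles\<close>

lemma smooth_mapI:
  assumes "smooth_on UNIV f"
  shows "smooth_map M f"
  unfolding smooth_map_def using assms by (intro ballI exI[of _ UNIV] exI[of _ f]) simp

lemma smooth_mapE:
  assumes "smooth_map M f" "p \<in> M"
  obtains U F where "open U" "p \<in> U" "smooth_on U F" "\<forall>q\<in>M \<inter> U. F q = f q"
proof -
  have "\<exists>U F. open U \<and> p \<in> U \<and> smooth_on U F \<and> (\<forall>q\<in>M \<inter> U. F q = f q)"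
    using assms by (simp add: smooth_map_def)
  then show ?thesis
    by (elim exE conjE) (rule that)
qed

lemma smooth_map_subset:
  assumes "smooth_map M f" "N \<subseteq> M"
  shows "smooth_map N f"
  unfolding smooth_map_def
proof
  fix p assume "p \<in> N"
  then have "p \<in> M"
    using assms(2) by auto
  then obtain U F where "open U" "p \<in> U" "smooth_on U F" "\<forall>q\<in>M \<inter> U. F q = f q"
    by (rule smooth_mapE[OF assms(1)])
  then show "\<exists>U F. open U \<and> p \<in> U \<and> smooth_on U F \<and> (\<forall>q\<in>N \<inter> U. F q = f q)"
    using assms(2) by (intro exI[of _ U] exI[of _ F]) auto
qed

text \<open>Near each point the map is the restriction of a smooth, hence continuous,
  \<open>F\<close>. In this way smooth conformal factors yield a continuous sign.\<close>

lemma smooth_map_imp_continuous_on: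
  assumes "smooth_map M f"
  shows "continuous_on M f"
  unfolding continuous_on_eq_continuous_within
proof
  fix p assume p: "p \<in> M"
  then obtain U F where U: "open U" "p \<in> U" "smooth_on U F" "\<forall>q\<in>M \<inter> U. F q = f q"
    by (rule smooth_mapE[OF assms])
  have "continuous_on U F"
    using U(3) unfolding smooth_on_def by (metis Ck_on.simps(1))
  then have "continuous (at p within M) F"
    using U(1,2) by (simp add: continuous_on_eq_continuous_at continuous_at_imp_continuous_at_within)
  then have "(F \<longlongrightarrow> F p) (at p within M)"
    by (simp add: continuous_within)
  moreover have "\<forall>\<^sub>F q in at p within M. F q = f q"
    unfolding eventually_at_topological using U by (intro exI[of _ U]) auto
  ultimately have "(f \<longlongrightarrow> F p) (at p within M)"
    by (rule Lim_transform_eventually)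
  then show "continuous (at p within M) f"
    using U p by (simp add: continuous_within)
qed

lemma smooth_map_bilinear:
  fixes B :: "'b::euclidean_space \<Rightarrow> 'c::euclidean_space \<Rightarrow> 'd::real_normed_vector"
  assumes "bilinear B" "smooth_map M f" "smooth_map M g"
  shows "smooth_map M (\<lambda>x. B (f x) (g x))"
  unfolding smooth_map_def
proof
  fix p assume p: "p \<in> M"
  obtain U F where U: "open U" "p \<in> U" "smooth_on U F" "\<forall>q\<in>M \<inter> U. F q = f q"
    by (rule smooth_mapE[OF assms(2) p])
  obtain V G where V: "open V" "p \<in> V" "smooth_on V G" "\<forall>q\<in>M \<inter> V. G q = g q"
    by (rule smooth_mapE[OF assms(3) p])
  have "smooth_on (U \<inter> V) (\<lambda>x. B (F x) (G x))"
    by (rule smooth_on_bilinear[OF assms(1) open_Int[OF U(1) V(1)]])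
      (use smooth_on_subset[OF U(3)] smooth_on_subset[OF V(3)] in auto)
  then show "\<exists>W H. open W \<and> p \<in> W \<and> smooth_on W H \<and> (\<forall>q\<in>M \<inter> W. H q = B (f q) (g q))"
    using U V by (intro exI[of _ "U \<inter> V"] exI[of _ "\<lambda>x. B (F x) (G x)"]) auto
qed

text \<open>A frame of \<open>E'\<close> remains a frame of \<open>E\<close> once its neighbourhood
  is shrunk to where both agree. The bundle \<open>E'\<close> may change with the point, as suits
  eigenbundles whose sign is known to be constant only locally.\<close>

lemma smooth_subbundle_local:
  assumes "\<And>p. p \<in> M \<Longrightarrow>
    \<exists>U E'. open U \<and> p \<in> U \<and> smooth_subbundle k M E' \<and> (\<forall>q\<in>M \<inter> U. E q = E' q)"
  shows "smooth_subbundle k M E"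
proof -
  have "subspace (E p) \<and> E p \<subseteq> tangent_space M p \<and> dim (E p) = k" if p: "p \<in> M" for p
  proof -
    obtain U E' where "p \<in> U" "smooth_subbundle k M E'" "\<forall>q\<in>M \<inter> U. E q = E' q"
      using assms[OF p] by metis
    then show ?thesis
      using p by (simp add: smooth_subbundle_def)
  qed
  moreover have "\<exists>U X. open U \<and> p \<in> U \<and> (\<forall>i<k. smooth_map (M \<inter> U) (X i)) \<and>
        (\<forall>q\<in>M \<inter> U. E q = span ((\<lambda>i. X i q) ` {..<k}))" if p: "p \<in> M" for p
  proof -
    obtain U E' where U: "open U" "p \<in> U" "smooth_subbundle k M E'" "\<forall>q\<in>M \<inter> U. E q = E' q"
      using assms[OF p] by metis
    have "\<exists>V X. open V \<and> p \<in> V \<and> (\<forall>i<k. smooth_map (M \<inter> V) (X i)) \<and>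
        (\<forall>q\<in>M \<inter> V. E' q = span ((\<lambda>i. X i q) ` {..<k}))"
      using U(3) p by (simp add: smooth_subbundle_def)
    then obtain V X where V: "open V" "p \<in> V" "\<forall>i<k. smooth_map (M \<inter> V) (X i)"
        "\<forall>q\<in>M \<inter> V. E' q = span ((\<lambda>i. X i q) ` {..<k})"
      by metis
    have "smooth_map (M \<inter> (U \<inter> V)) (X i)" if "i < k" for i
      by (rule smooth_map_subset[of "M \<inter> V"]) (use V(3) that in auto)
    then show ?thesis
      using U V by (intro exI[of _ "U \<inter> V"] exI[of _ X]) auto
  qed
  ultimately show ?thesis
    by (simp add: smooth_subbundle_def)
qed

section \<open>The saucer space as a contact manifold\<close>

text \<open>Inversion in the unit sphere. Since \<open>inverse 0 = 0\<close> it fixes the origin,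
  and so is an involution of the whole space.\<close>

definition inversion :: "'a::real_inner \<Rightarrow> 'a" where
  "inversion x = inverse (x \<bullet> x) *\<^sub>R x"

lemma inversion_inversion [simp]: "inversion (inversion x) = x"
  by (cases "x = 0") (auto simp: inversion_def field_simps)

lemma inversion_eq_0_iff [simp]: "inversion x = 0 \<longleftrightarrow> x = 0"
  by (metis inversion_inversion inversion_def scaleR_zero_right)

lemma smooth_on_inversion:
  fixes f :: "'a::euclidean_space \<Rightarrow> 'b::euclidean_space"
  assumes "open S" "smooth_on S f" "\<And>x. x \<in> S \<Longrightarrow> f x \<noteq> 0"
  shows "smooth_on S (\<lambda>x. inversion (f x))"
  unfolding inversion_def using assms
  by (auto intro!: smooth_on_scaleR smooth_on_inverse smooth_on_inner)

lemma smooth_on_fst: "open S \<Longrightarrow> smooth_on S (fst :: 'a::euclidean_space \<times> 'b::euclidean_space \<Rightarrow> 'a)"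
  using smooth_on_linear[OF linear_fst _ smooth_on_ident] .

lemma smooth_on_snd: "open S \<Longrightarrow> smooth_on S (snd :: 'a::euclidean_space \<times> 'b::euclidean_space \<Rightarrow> 'b)"
  using smooth_on_linear[OF linear_snd _ smooth_on_ident] .

text \<open>One statement serves both the chart, with parameters \<open>a\<close> and
  \<open>- b\<close>, and its inverse, with parameters \<open>b\<close> and
  \<open>- a\<close>.\<close>

lemma smooth_on_translated_inversion:
  fixes a b :: "'b::euclidean_space"
  shows "smooth_on {p :: 'a::euclidean_space \<times> 'b. snd p \<noteq> - a} (\<lambda>p. (fst p, inversion (snd p + a) + b))"
proof -
  have "{p :: 'a \<times> 'b. snd p \<noteq> - a} = UNIV \<times> (- {- a})"
    by auto
  then have op: "open {p :: 'a \<times> 'b. snd p \<noteq> - a}"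
    by (auto intro: open_Times)
  show ?thesis
    using op
    by (intro smooth_on_Pair smooth_on_add smooth_on_inversion smooth_on_const smooth_on_fst
        smooth_on_snd) (auto simp: add_eq_0_iff2)
qed

text \<open>
  The inversion with pole \<open>-a\<close> on the unit sphere maps the rest of the sphere to the affine hyperplane
  \<open>m \<bullet> a = 1/2\<close>, and it is rational with rational inverse: no square roots appear in the chart.
\<close>

lemma inversion_sphere_iff:
  assumes "norm a = 1" "n \<noteq> - a"
  shows "norm n = 1 \<longleftrightarrow> inversion (n + a) \<bullet> a = 1 / 2"
proof -
  let ?x = "n + a"
  have "?x \<noteq> 0"
    using assms(2) by (simp add: add_eq_0_iff2)
  then have x: "?x \<bullet> ?x \<noteq> 0"
    by simp
  have a: "a \<bullet> a = 1"
    using assms(1) by (simp add: norm_eq_1)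
  have "norm n = 1 \<longleftrightarrow> n \<bullet> n = 1"
    by (simp add: norm_eq_1)
  \<comment> \<open>As \<open>n = ?x - a\<close> with \<open>a\<close> a unit vector,
    \<open>n \<bullet> n = ?x \<bullet> ?x - 2 * (?x \<bullet> a) + 1\<close>.\<close>
  also have "\<dots> \<longleftrightarrow> 2 * (?x \<bullet> a) = ?x \<bullet> ?x"
    using a by (auto simp: inner_add inner_commute)
  also have "\<dots> \<longleftrightarrow> inversion ?x \<bullet> a = 1 / 2"
    using x unfolding inversion_def inner_scaleR_left
    by (simp add: divide_simps del: inner_eq_zero_iff) (auto simp: algebra_simps)
  finally show ?thesis .
qed

text \<open>The pole is antipodal to \<open>snd p\<close>, so that \<open>p\<close> lies in the
  domain of the chart; a hyperplane of the six-dimensional ambient space gives dimension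
  five.\<close>

lemma embedded_submanifold_saucer_space: "embedded_submanifold 5 saucer_space"
  unfolding embedded_submanifold_def
proof
  fix p assume "p \<in> saucer_space"
  then have p: "norm (snd p) = 1"
    by (auto simp: saucer_space_def)
  define a where "a = snd p"
  have a: "norm a = 1" "a \<noteq> 0" "a \<bullet> a = 1"
    using p by (auto simp: a_def norm_eq_1)
  \<comment> \<open>As \<open>b \<bullet> a = 1 / 2\<close>, translating by \<open>- b\<close> turns
    the affine hyperplane that contains the inverted sphere into a linear one.\<close>
  define b where "b = (1 / 2) *\<^sub>R a"
  define U where "U = {q :: (real^3) \<times> (real^3). snd q \<noteq> - a}"
  \<comment> \<open>The value \<open>- b\<close> is left out because the inversion of a nonzero
    vector is never zero.\<close>
  define V where "V = {q :: (real^3) \<times> (real^3). snd q \<noteq> - b}"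
  define \<phi> where "\<phi> = (\<lambda>q :: (real^3) \<times> (real^3). (fst q, inversion (snd q + a) + - b))"
  define \<psi> where "\<psi> = (\<lambda>q :: (real^3) \<times> (real^3). (fst q, inversion (snd q + b) + - a))"
  define L where "L = {q :: (real^3) \<times> (real^3). (0, a) \<bullet> q = 0}"
  have "U = UNIV \<times> (- {- a})" "V = UNIV \<times> (- {- b})"
    by (auto simp: U_def V_def)
  then have op: "open U" "open V"
    by (auto intro: open_Times)
  have sm: "smooth_on U \<phi>" "smooth_on V \<psi>"
    unfolding U_def V_def \<phi>_def \<psi>_def by (rule smooth_on_translated_inversion)+
  have cont: "continuous_on U \<phi>" "continuous_on V \<psi>"
    using sm unfolding smooth_on_def by (metis Ck_on.simps(1))+
  have \<psi>\<phi>: "\<phi> q \<in> V \<and> \<psi> (\<phi> q) = q" if "q \<in> U" for q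
    using that by (auto simp: U_def V_def \<phi>_def \<psi>_def add_eq_0_iff2 prod_eq_iff)
  have \<phi>\<psi>: "\<psi> q \<in> U \<and> \<phi> (\<psi> q) = q" if "q \<in> V" for q
    using that by (auto simp: U_def V_def \<phi>_def \<psi>_def add_eq_0_iff2 prod_eq_iff)
  have hom: "homeomorphism U V \<phi> \<psi>"
    using \<psi>\<phi> \<phi>\<psi> cont by (intro homeomorphismI) auto
  have iff: "q \<in> saucer_space \<longleftrightarrow> \<phi> q \<in> L" if "q \<in> U" for q
  proof -
    have "q \<in> saucer_space \<longleftrightarrow> inversion (snd q + a) \<bullet> a = 1 / 2"
      using inversion_sphere_iff[OF a(1), of "snd q"] that
      by (auto simp: saucer_space_def U_def mem_Times_iff)
    also have "\<dots> \<longleftrightarrow> \<phi> q \<in> L"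
      by (auto simp: L_def \<phi>_def b_def inner_diff_right inner_commute a(3))
    finally show ?thesis .
  qed
  have img: "\<phi> ` (U \<inter> saucer_space) = V \<inter> L"
  proof (intro equalityI subsetI)
    fix q assume "q \<in> V \<inter> L"
    then have "q = \<phi> (\<psi> q)" "\<psi> q \<in> U \<inter> saucer_space"
      using \<phi>\<psi> iff by auto
    then show "q \<in> \<phi> ` (U \<inter> saucer_space)"
      by blast
  qed (use \<psi>\<phi> iff in auto)
  have "subspace L"
    unfolding L_def by (rule subspace_hyperplane)
  moreover have "dim L = 5"
    unfolding L_def using a(2) by (subst dim_hyperplane) (auto simp: zero_prod_def)
  moreover have "a \<noteq> - a"
  proof
    assume "a = - a"
    then have "a \<bullet> a = - (a \<bullet> a)"
      by (metis inner_minus_left)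
    then show False
      using a(3) by simp
  qed
  then have "p \<in> U"
    by (simp add: U_def a_def)
  ultimately show "\<exists>U V \<phi> \<psi> L. open U \<and> p \<in> U \<and> open (V :: ((real^3) \<times> (real^3)) set) \<and>
      homeomorphism U V \<phi> \<psi> \<and> smooth_on U \<phi> \<and> smooth_on V \<psi> \<and> subspace L \<and> dim L = 5 \<and>
      \<phi> ` (U \<inter> saucer_space) = V \<inter> L"
    using op hom sm img by (intro exI[of _ U] exI[of _ V] exI[of _ \<phi>] exI[of _ \<psi>] exI[of _ L]) simp
qed

section \<open>Curves on the sphere and tangent spaces\<close>

text \<open>Differentiate the constant \<open>n \<bullet> n\<close>. Working within \<open>I\<close>
  covers one-sided derivatives, and \<open>at t within I \<noteq> bot\<close> makes the derivative
  unique.\<close>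

lemma has_vector_derivative_unit_orthogonal:
  fixes n :: "real \<Rightarrow> 'a::real_inner"
  assumes "(n has_vector_derivative w) (at t within I)" "at t within I \<noteq> bot" "t \<in> I"
    and "\<And>s. s \<in> I \<Longrightarrow> norm (n s) = 1"
  shows "n t \<bullet> w = 0"
proof -
  have "((\<lambda>s. n s \<bullet> n s) has_vector_derivative (n t \<bullet> w + w \<bullet> n t)) (at t within I)"
    using assms(1) unfolding has_vector_derivative_def
    by (auto intro!: derivative_eq_intros simp: algebra_simps)
  moreover have "((\<lambda>s. n s \<bullet> n s) has_vector_derivative 0) (at t within I)"
    using assms(3,4) norm_eq_1
    by (intro has_vector_derivative_transform[OF _ _ has_vector_derivative_const[of 1]]) auto
  ultimately have "n t \<bullet> w + w \<bullet> n t = 0"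
    using vector_derivative_within[OF assms(2)] by metis
  then show ?thesis
    by (simp add: inner_commute)
qed

text \<open>The great circle through \<open>n\<close> in direction \<open>w\<close>, parametrised
  rationally by the tangent of half the angle, up to scale, so that no trigonometric functions
  enter. For \<open>w = 0\<close> the curve is constant.\<close>

lemma unit_sphere_curve:
  fixes n w :: "'a::euclidean_space"
  assumes "norm n = 1" "n \<bullet> w = 0"
  obtains \<gamma> :: "real \<Rightarrow> 'a" where "smooth_on UNIV \<gamma>" "\<And>t. norm (\<gamma> t) = 1" "\<gamma> 0 = n"
    "(\<gamma> has_vector_derivative w) (at 0)"
proof -
  \<comment> \<open>With \<open>w \<bullet> w = 4 * k\<close> the squared length becomes
    \<open>((1 - k t^2)^2 + 4 k t^2) / (1 + k t^2)^2 = 1\<close>.\<close>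
  define k where "k = (w \<bullet> w) / 4"
  have k: "k \<ge> 0"
    by (simp add: k_def)
  have pos: "1 + k * (t * t) > 0" for t
    using k by (simp add: add_pos_nonneg)
  define \<alpha> where "\<alpha> t = inverse (1 + k * (t * t)) * (1 + (- k) * (t * t))" for t :: real
  define \<beta> where "\<beta> t = inverse (1 + k * (t * t)) * t" for t :: real
  define \<gamma> where "\<gamma> t = \<alpha> t *\<^sub>R n + \<beta> t *\<^sub>R w" for t
  have mult: "smooth_on UNIV (\<lambda>t. f t * g t)" if "smooth_on UNIV f" "smooth_on UNIV g"
    for f g :: "real \<Rightarrow> real"
    using smooth_on_inner[OF _ that] by simp
  have "smooth_on UNIV (\<lambda>t. 1 + c * (t * t))" for c :: real
    by (intro smooth_on_add mult smooth_on_const smooth_on_ident) auto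
  then have "smooth_on UNIV \<alpha>" "smooth_on UNIV \<beta>"
    unfolding \<alpha>_def \<beta>_def using pos
    by (intro mult smooth_on_inverse smooth_on_ident open_UNIV; metis less_irrefl)+
  then have "smooth_on UNIV \<gamma>"
    unfolding \<gamma>_def by (intro smooth_on_add smooth_on_scaleR smooth_on_const) auto
  moreover have "norm (\<gamma> t) = 1" for t
  proof -
    have "\<gamma> t \<bullet> \<gamma> t = (\<alpha> t)\<^sup>2 + (\<beta> t)\<^sup>2 * (4 * k)"
      using assms by (simp add: \<gamma>_def inner_add inner_commute norm_eq_1 k_def power2_eq_square)
    also have "\<dots> = 1"
      using pos[of t] unfolding \<alpha>_def \<beta>_def
      by (simp add: divide_simps power2_eq_square) (simp add: algebra_simps)
    finally show ?thesis
      by (simp add: norm_eq_1)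
  qed
  moreover have "\<gamma> 0 = n"
    by (simp add: \<gamma>_def \<alpha>_def \<beta>_def)
  moreover have "(\<gamma> has_vector_derivative w) (at 0)"
  proof -
    have "(\<alpha> has_real_derivative 0) (at 0)" "(\<beta> has_real_derivative 1) (at 0)"
      unfolding \<alpha>_def \<beta>_def by (auto intro!: derivative_eq_intros)
    then have "(\<gamma> has_vector_derivative (0 *\<^sub>R n + 1 *\<^sub>R w)) (at 0)"
      unfolding \<gamma>_def
      by (intro has_vector_derivative_add) (auto intro!: derivative_eq_intros)
    then show ?thesis
      by simp
  qed
  ultimately show ?thesis
    by (rule that)
qed

text \<open>Unit length forces \<open>snd X\<close> to be orthogonal to \<open>snd p\<close>;
  conversely a straight line in the first factor and a great circle in the second realise every such
  \<open>X\<close>.\<close>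

lemma tangent_space_saucer:
  assumes "p \<in> saucer_space"
  shows "tangent_space saucer_space p = {X. snd p \<bullet> snd X = 0}"
proof (intro equalityI subsetI)
  fix X assume "X \<in> tangent_space saucer_space p"
  then obtain \<gamma> and e :: real where e: "e > 0" "\<gamma> ` {-e<..<e} \<subseteq> saucer_space" "\<gamma> 0 = p"
      and d: "(\<gamma> has_vector_derivative X) (at 0)"
    unfolding tangent_space_def by blast
  have "((\<lambda>t. snd (\<gamma> t)) has_vector_derivative snd X) (at 0)"
    using bounded_linear.has_vector_derivative[OF bounded_linear_snd d] .
  then have "((\<lambda>t. snd (\<gamma> t)) has_vector_derivative snd X) (at 0 within {-e<..<e})"
    by (rule has_vector_derivative_at_within)
  moreover have "norm (snd (\<gamma> s)) = 1" if "s \<in> {-e<..<e}" for s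
    using e(2) that by (auto simp: saucer_space_def image_subset_iff mem_Times_iff)
  moreover have "at (0::real) within {-e<..<e} \<noteq> bot"
    using e(1) by (simp add: at_within_open[of 0 "{-e<..<e}"])
  ultimately have "snd (\<gamma> 0) \<bullet> snd X = 0"
    using e(1) by (intro has_vector_derivative_unit_orthogonal) auto
  then show "X \<in> {X. snd p \<bullet> snd X = 0}"
    using e(3) by simp
next
  fix X :: "(real^3) \<times> (real^3)"
  assume "X \<in> {X. snd p \<bullet> snd X = 0}"
  then have "snd p \<bullet> snd X = 0" "norm (snd p) = 1"
    using assms by (auto simp: saucer_space_def)
  then obtain \<gamma> :: "real \<Rightarrow> real^3" where \<gamma>: "smooth_on UNIV \<gamma>" "\<And>t. norm (\<gamma> t) = 1"
      "\<gamma> 0 = snd p" "(\<gamma> has_vector_derivative snd X) (at 0)"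
    using unit_sphere_curve by blast
  define \<delta> where "\<delta> t = (fst p + t *\<^sub>R fst X, \<gamma> t)" for t
  have "smooth_on UNIV \<delta>"
    unfolding \<delta>_def
    by (intro smooth_on_Pair smooth_on_add smooth_on_scaleR smooth_on_const smooth_on_ident \<gamma>) auto
  then have "smooth_on {-1<..<1} \<delta>"
    by (rule smooth_on_subset) simp
  moreover have "(\<delta> has_vector_derivative (0 + 1 *\<^sub>R fst X, snd X)) (at 0)"
    unfolding \<delta>_def
    by (intro has_vector_derivative_Pair \<gamma> has_vector_derivative_add has_vector_derivative_const)
      (auto intro!: derivative_eq_intros)
  moreover have "\<delta> ` {-1<..<1} \<subseteq> saucer_space"
    using \<gamma>(2) by (auto simp: \<delta>_def saucer_space_def)
  moreover have "\<delta> 0 = p"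
    using \<gamma>(3) by (simp add: \<delta>_def)
  ultimately show "X \<in> tangent_space saucer_space p"
    unfolding tangent_space_def by (intro CollectI exI[of _ \<delta>] exI[of _ 1]) simp
qed

section \<open>The contact form\<close>

lemma ker_dist_saucer:
  "p \<in> saucer_space \<Longrightarrow>
    ker_dist saucer_space saucer_form p = {X. snd p \<bullet> fst X = 0 \<and> snd p \<bullet> snd X = 0}"
  by (auto simp: ker_dist_def tangent_space_saucer saucer_form_def)

text \<open>The form is linear in the base point, so its exterior derivative has constant
  coefficients: it is the sum of the \<open>dn_i wedge dr_i\<close>.\<close>

lemma ext_deriv_saucer: "ext_deriv saucer_form p X Y = snd X \<bullet> fst Y - snd Y \<bullet> fst X"
proof -
  have "((\<lambda>q. saucer_form q Z) has_derivative (\<lambda>X. snd X \<bullet> fst Z)) (at p)" for Z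
    unfolding saucer_form_def by (auto intro!: derivative_eq_intros)
  then have "frechet_derivative (\<lambda>q. saucer_form q Z) (at p) = (\<lambda>X. snd X \<bullet> fst Z)" for Z
    using frechet_derivative_at by metis
  then show ?thesis
    by (simp add: ext_deriv_def)
qed

lemma contact_form_saucer: "contact_form 2 saucer_space saucer_form"
  unfolding contact_form_def
proof (intro conjI ballI impI)
  show "embedded_submanifold (2 * 2 + 1) saucer_space"
    using embedded_submanifold_saucer_space by simp
  show "smooth_one_form saucer_space saucer_form"
    unfolding smooth_one_form_def saucer_form_def
    by (intro exI[of _ UNIV])
      (auto intro!: linearI smooth_on_inner smooth_on_snd smooth_on_const simp: inner_add_right)
next
  fix p assume p: "p \<in> saucer_space"
  then have "snd p \<bullet> snd p = 1"
    by (auto simp: saucer_space_def norm_eq_1)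
  \<comment> \<open>Moving the centre along the normal gives the value
    \<open>snd p \<bullet> snd p = 1\<close>.\<close>
  then show "\<exists>X\<in>tangent_space saucer_space p. saucer_form p X \<noteq> 0"
    using p by (intro bexI[of _ "(snd p, 0)"]) (auto simp: tangent_space_saucer saucer_form_def)
  fix X assume X: "X \<in> ker_dist saucer_space saucer_form p"
    and 0: "\<forall>Y\<in>ker_dist saucer_space saucer_form p. ext_deriv saucer_form p X Y = 0"
  \<comment> \<open>Testing \<open>X\<close> against these two vectors returns, up to sign, the
    squared lengths of \<open>snd X\<close> and \<open>fst X\<close>.\<close>
  have "(snd X, 0) \<in> ker_dist saucer_space saucer_form p"
      "(0, fst X) \<in> ker_dist saucer_space saucer_form p"
    using X p by (auto simp: ker_dist_saucer)
  then have "snd X \<bullet> snd X = 0" "fst X \<bullet> fst X = 0"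
    using 0 by (force simp: ext_deriv_saucer)+
  then show "X = 0"
    by (simp add: prod_eq_iff)
qed

section \<open>The null directions and the endomorphism of the metric\<close>

lemma dim_orthogonal:
  fixes n :: "real^3"
  assumes "norm n = 1"
  shows "dim {x. n \<bullet> x = 0} = 2"
  using assms by (subst dim_hyperplane) auto

text \<open>The two factors of the fibre, its diagonal and its antidiagonal are all such images of
  the plane orthogonal to \<open>n\<close>, so their dimensions are found once.\<close>

lemma subspace_dim_injective_image:
  fixes J :: "real^3 \<Rightarrow> 'b::euclidean_space"
  assumes "linear J" "inj J" "norm n = 1"
  shows "subspace (J ` {x. n \<bullet> x = 0})" "dim (J ` {x. n \<bullet> x = 0}) = 2"
proof -
  show "subspace (J ` {x. n \<bullet> x = 0})"
    by (intro linear_subspace_image assms subspace_hyperplane)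
  show "dim (J ` {x. n \<bullet> x = 0}) = 2"
    using dim_image_eq[OF assms(1) inj_on_subset[OF assms(2)]] dim_orthogonal[OF assms(3)] by simp
qed

text \<open>Lagrange's identity evaluates \<open>cross3 m (cross3 x (cross3 a b))\<close> in two
  ways. For fixed \<open>a\<close> and \<open>b\<close> the spanning vectors are linear in
  \<open>m\<close>, hence a smooth frame as \<open>m\<close> varies.\<close>

lemma orthogonal_eq_span_cross3:
  assumes "m \<bullet> cross3 a b \<noteq> 0"
  shows "{x. m \<bullet> x = 0} = span {cross3 m a, cross3 m b}"
proof (intro equalityI subsetI)
  fix x assume "x \<in> {x. m \<bullet> x = 0}"
  then have "cross3 m (cross3 x (cross3 a b)) = (m \<bullet> cross3 a b) *\<^sub>R x"
    by (simp add: Lagrange[of m])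
  moreover have "cross3 m (cross3 x (cross3 a b)) = (x \<bullet> b) *\<^sub>R cross3 m a - (x \<bullet> a) *\<^sub>R cross3 m b"
    by (simp add: Lagrange[of x] Cross3.right_diff_distrib cross_mult_right)
  ultimately have "x = inverse (m \<bullet> cross3 a b) *\<^sub>R
      ((x \<bullet> b) *\<^sub>R cross3 m a - (x \<bullet> a) *\<^sub>R cross3 m b)"
    using assms by simp
  moreover have "\<dots> \<in> span {cross3 m a, cross3 m b}"
    by (intro span_scale span_diff span_base) auto
  ultimately show "x \<in> span {cross3 m a, cross3 m b}"
    by metis
next
  fix x assume "x \<in> span {cross3 m a, cross3 m b}"
  moreover have "span {cross3 m a, cross3 m b} \<subseteq> {x. m \<bullet> x = 0}"
    by (intro span_minimal subspace_hyperplane) (auto simp: dot_cross_self)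
  ultimately show "x \<in> {x. m \<bullet> x = 0}"
    by blast
qed

text \<open>With constant \<open>a\<close> and \<open>b\<close> the frame
  \<open>J (cross3 n a)\<close>, \<open>J (cross3 n b)\<close> is linear in the normal
  \<open>n\<close> and defined on the whole ambient space, and the condition under which it spans is
  open.\<close>

lemma smooth_subbundle_saucer:
  fixes J :: "real^3 \<Rightarrow> (real^3) \<times> (real^3)"
  assumes J: "linear J" "inj J"
    and tangent: "\<And>p x. p \<in> saucer_space \<Longrightarrow> snd p \<bullet> x = 0 \<Longrightarrow> snd p \<bullet> snd (J x) = 0"
  shows "smooth_subbundle 2 saucer_space (\<lambda>p. J ` {x. snd p \<bullet> x = 0})"
  unfolding smooth_subbundle_def
proof (intro conjI ballI)
  fix p assume p: "p \<in> saucer_space"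
  then have n: "norm (snd p) = 1"
    by (auto simp: saucer_space_def)
  show "subspace (J ` {x. snd p \<bullet> x = 0})" "dim (J ` {x. snd p \<bullet> x = 0}) = 2"
    by (rule subspace_dim_injective_image[OF J n])+
  show "J ` {x. snd p \<bullet> x = 0} \<subseteq> tangent_space saucer_space p"
    using tangent[OF p] by (simp add: image_subset_iff tangent_space_saucer[OF p])
  obtain a where a: "a \<noteq> 0" "snd p \<bullet> a = 0"
    using orthogonal_to_vector_exists[of "snd p"] by (auto simp: orthogonal_def)
  \<comment> \<open>At \<open>p\<close> this choice gives
    \<open>snd p \<bullet> cross3 a b = a \<bullet> a > 0\<close>, so that
    \<open>p \<in> U\<close>.\<close>
  define b where "b = cross3 (snd p) a"
  define U where "U = {q :: (real^3) \<times> (real^3). snd q \<bullet> cross3 a b \<noteq> 0}"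
  define X where "X i q = J (cross3 (snd q) (if i = 0 then a else b))"
    for i :: nat and q :: "(real^3) \<times> (real^3)"
  have "open U"
    unfolding U_def by (intro open_Collect_neq continuous_intros)
  moreover have "p \<in> U"
    using a n by (simp add: U_def b_def Lagrange[of a] inner_diff_right norm_eq_1)
  moreover have "smooth_map (saucer_space \<inter> U) (X i)" for i
  proof (rule smooth_mapI)
    have "linear (\<lambda>y. J (cross3 y c))" for c
      using linear_compose[OF _ J(1), of "\<lambda>y. cross3 y c"] bilinear_cross
      by (simp add: bilinear_def o_def)
    then show "smooth_on UNIV (X i)"
      unfolding X_def by (intro smooth_on_linear[OF _ _ smooth_on_snd]) auto
  qed
  moreover have "J ` {x. snd q \<bullet> x = 0} = span ((\<lambda>i. X i q) ` {..<2})" if "q \<in> U" for q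
  proof -
    have "(\<lambda>i. X i q) ` {..<2} = J ` {cross3 (snd q) a, cross3 (snd q) b}"
      by (auto simp: X_def numeral_2_eq_2 lessThan_Suc)
    then show ?thesis
      using that J(1)
      by (simp add: linear_span_image U_def orthogonal_eq_span_cross3 del: image_insert)
  qed
  ultimately show "\<exists>U X. open U \<and> p \<in> U \<and> (\<forall>i<2::nat. smooth_map (saucer_space \<inter> U) (X i)) \<and>
      (\<forall>q\<in>saucer_space \<inter> U. J ` {x. snd q \<bullet> x = 0} = span ((\<lambda>i. X i q) ` {..<2}))"
    by (intro exI[of _ U] exI[of _ X]) simp
qed

text \<open>The coordinate inclusions parametrise the eigenbundles; the diagonal and antidiagonal
  maps parametrise the definite planes of the metric.\<close>

lemma linear_inj_factors:
  "linear (\<lambda>x :: real^3. (x, 0 :: real^3))" "inj (\<lambda>x :: real^3. (x, 0 :: real^3))"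
  "linear (\<lambda>x :: real^3. (0 :: real^3, x))" "inj (\<lambda>x :: real^3. (0 :: real^3, x))"
  "linear (\<lambda>x :: real^3. (x, x))" "inj (\<lambda>x :: real^3. (x, x))"
  "linear (\<lambda>x :: real^3. (x, - x))" "inj (\<lambda>x :: real^3. (x, - x))"
  by (auto intro!: linearI injI)

section \<open>The split signature metric\<close>

lemma bilinear_saucer_metric: "bilinear (saucer_metric p)"
  unfolding bilinear_def saucer_metric_def
  by (auto intro!: linearI simp: inner_add field_simps)

text \<open>Polarisation: \<open>v \<bullet> w\<close> is the squared length of
  \<open>(v + w) / 2\<close> minus that of \<open>(v - w) / 2\<close>, and these are the components
  of \<open>(v, w)\<close> along diagonal and antidiagonal.\<close>

lemma has_signature_saucer:
  assumes "p \<in> saucer_space"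
  shows "has_signature (ker_dist saucer_space saucer_form p) (saucer_metric p) 2 2"
proof -
  let ?n = "{x. snd p \<bullet> x = 0}"
  let ?P = "(\<lambda>x. (x, x)) ` ?n" and ?N = "(\<lambda>x. (x, - x)) ` ?n"
  have n: "norm (snd p) = 1"
    using assms by (auto simp: saucer_space_def)
  have "X \<in> ker_dist saucer_space saucer_form p \<longleftrightarrow> X \<in> {X + Y | X Y. X \<in> ?P \<and> Y \<in> ?N}" for X
  proof
    assume "X \<in> ker_dist saucer_space saucer_form p"
    then have "(1 / 2) *\<^sub>R (fst X + snd X) \<in> ?n" "(1 / 2) *\<^sub>R (fst X - snd X) \<in> ?n"
      using assms by (auto simp: ker_dist_saucer inner_add_right inner_diff_right)
    moreover have "X = ((1 / 2) *\<^sub>R (fst X + snd X), (1 / 2) *\<^sub>R (fst X + snd X)) +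
        ((1 / 2) *\<^sub>R (fst X - snd X), - ((1 / 2) *\<^sub>R (fst X - snd X)))"
      by (auto simp: prod_eq_iff simp flip: scaleR_add_right scaleR_diff_right scaleR_2)
    ultimately show "X \<in> {X + Y | X Y. X \<in> ?P \<and> Y \<in> ?N}"
      by blast
  next
    assume "X \<in> {X + Y | X Y. X \<in> ?P \<and> Y \<in> ?N}"
    then show "X \<in> ker_dist saucer_space saucer_form p"
      using assms by (auto simp: ker_dist_saucer inner_add_right inner_diff_right)
  qed
  then have "ker_dist saucer_space saucer_form p = {X + Y | X Y. X \<in> ?P \<and> Y \<in> ?N}"
    by blast
  moreover note subspace_dim_injective_image[OF linear_inj_factors(5,6) n]
    subspace_dim_injective_image[OF linear_inj_factors(7,8) n]
  moreover have "\<forall>X\<in>?P. \<forall>Y\<in>?N. saucer_metric p X Y = 0"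
    by (auto simp: saucer_metric_def inner_commute)
  moreover have "\<forall>X\<in>?P. X \<noteq> 0 \<longrightarrow> saucer_metric p X X > 0"
    "\<forall>X\<in>?N. X \<noteq> 0 \<longrightarrow> saucer_metric p X X < 0"
    by (auto simp: saucer_metric_def zero_prod_def)
  ultimately show ?thesis
    unfolding has_signature_def by (intro exI[of _ ?P] exI[of _ ?N]) simp
qed

lemma metric_of_signature_saucer:
  "metric_of_signature saucer_space (ker_dist saucer_space saucer_form) saucer_metric 2 2"
  unfolding metric_of_signature_def
proof (intro conjI ballI allI impI)
  fix p X Y
  show "linear_within (ker_dist saucer_space saucer_form p) (saucer_metric p X)"
    using bilinear_saucer_metric[of p]
    by (simp add: linear_within_def bilinear_radd bilinear_rmul)
  show "saucer_metric p X Y = saucer_metric p Y X"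
    by (simp add: saucer_metric_def inner_commute)
next
  fix U X Y
  assume "open U \<and> smooth_map (saucer_space \<inter> U) X \<and> smooth_map (saucer_space \<inter> U) Y \<and>
    (\<forall>p\<in>saucer_space \<inter> U. X p \<in> ker_dist saucer_space saucer_form p \<and>
      Y p \<in> ker_dist saucer_space saucer_form p)"
  \<comment> \<open>The metric does not depend on the base point, so freezing it at \<open>0\<close>
    gives a single bilinear map.\<close>
  then have "smooth_map (saucer_space \<inter> U) (\<lambda>p. saucer_metric 0 (X p) (Y p))"
    by (intro smooth_map_bilinear[OF bilinear_saucer_metric]) auto
  then show "smooth_map (saucer_space \<inter> U) (\<lambda>p. saucer_metric p (X p) (Y p))"
    by (simp add: saucer_metric_def)
qed (rule has_signature_saucer)

section \<open>Compatible endomorphisms and their eigenbundles\<close>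

text \<open>The two conformal factors enter \<open>K\<close> only through the quotient \<open>\<sigma>\<close>; \<open>K\<^sup>2 = id\<close> makes it a sign.\<close>

lemma compatible_endomorphism_saucerE:
  assumes "compatible_endomorphism saucer_space saucer_form saucer_metric K"
  obtains \<sigma> where "continuous_on saucer_space \<sigma>"
    "\<And>p. p \<in> saucer_space \<Longrightarrow> \<sigma> p = 1 \<or> \<sigma> p = -1"
    "\<And>p X. p \<in> saucer_space \<Longrightarrow> X \<in> ker_dist saucer_space saucer_form p \<Longrightarrow>
      K p X = (\<sigma> p *\<^sub>R fst X, - \<sigma> p *\<^sub>R snd X)"
proof -
  let ?D = "ker_dist saucer_space saucer_form"
  have "\<exists>g'\<in>conformal_metrics saucer_space ?D saucer_metric.
      \<exists>\<Omega>'\<in>conformal_two_forms saucer_space ?D (ext_deriv saucer_form).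
      \<forall>p\<in>saucer_space. K p ` ?D p \<subseteq> ?D p \<and>
        (\<forall>X\<in>?D p. \<forall>Y\<in>?D p. g' p X (K p Y) = \<Omega>' p X Y) \<and> (\<forall>X\<in>?D p. K p (K p X) = X)"
    using assms unfolding compatible_endomorphism_def Let_def
    by (elim bexE) (intro bexI ballI; simp)
  then obtain g' \<Omega>' where g': "g' \<in> conformal_metrics saucer_space ?D saucer_metric"
    and \<Omega>': "\<Omega>' \<in> conformal_two_forms saucer_space ?D (ext_deriv saucer_form)"
    and K: "\<forall>p\<in>saucer_space. K p ` ?D p \<subseteq> ?D p \<and>
        (\<forall>X\<in>?D p. \<forall>Y\<in>?D p. g' p X (K p Y) = \<Omega>' p X Y) \<and> (\<forall>X\<in>?D p. K p (K p X) = X)"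
    by (elim bexE)
  obtain f where f: "smooth_map saucer_space f" "\<forall>p\<in>saucer_space. f p > 0"
    "\<forall>p\<in>saucer_space. \<forall>X\<in>?D p. \<forall>Y\<in>?D p. g' p X Y = f p * saucer_metric p X Y"
    using g' by (auto simp: conformal_metrics_def)
  obtain h where h: "smooth_map saucer_space h"
    "\<forall>p\<in>saucer_space. \<forall>X\<in>?D p. \<forall>Y\<in>?D p. \<Omega>' p X Y = h p * ext_deriv saucer_form p X Y"
    using \<Omega>' by (auto simp: conformal_two_forms_def)
  \<comment> \<open>The factor 2 cancels the 1/2 of the symmetric product.\<close>
  define \<sigma> where "\<sigma> p = 2 * h p / f p" for p
  have "continuous_on saucer_space \<sigma>"
    unfolding \<sigma>_def using f(2)
    by (intro continuous_intros smooth_map_imp_continuous_on f(1) h(1)) auto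
  moreover have K_eq: "K p X = (\<sigma> p *\<^sub>R fst X, - \<sigma> p *\<^sub>R snd X)"
    if p: "p \<in> saucer_space" and X: "X \<in> ?D p" for p X
  proof -
    have KX: "K p X \<in> ?D p"
      using K p X by blast
    have fp: "f p > 0"
      using f(2) p by blast
    have eq: "fst Y \<bullet> snd (K p X) + fst (K p X) \<bullet> snd Y = \<sigma> p * (snd Y \<bullet> fst X - snd X \<bullet> fst Y)"
      if Y: "Y \<in> ?D p" for Y
    proof -
      have "f p * saucer_metric p Y (K p X) = h p * ext_deriv saucer_form p Y X"
        using K f(3) h(2) p X Y KX by metis
      then show ?thesis
        using fp by (simp add: saucer_metric_def ext_deriv_saucer \<sigma>_def field_simps)
    qed
    \<comment> \<open>Testing \<open>eq\<close> on the difference itself, placed in the other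
      factor, yields its squared length, which must therefore vanish. The second component is
      treated in the same way.\<close>
    have fst0: "fst (K p X) - \<sigma> p *\<^sub>R fst X = 0" (is "?u = 0")
    proof -
      have "(0, ?u) \<in> ?D p"
        using X KX p by (simp add: ker_dist_saucer inner_diff_right)
      from eq[OF this] have "?u \<bullet> ?u = 0"
        by (simp add: inner_diff_left inner_diff_right inner_commute algebra_simps)
      then show ?thesis
        by simp
    qed
    have "snd (K p X) + \<sigma> p *\<^sub>R snd X = 0" (is "?v = 0")
    proof -
      have "(?v, 0) \<in> ?D p"
        using X KX p by (simp add: ker_dist_saucer inner_add_right)
      from eq[OF this] have "?v \<bullet> ?v = 0"
        by (simp add: inner_add_left inner_add_right inner_commute algebra_simps)
      then show ?thesis
        by simp
    qed
    with fst0 show ?thesis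
      by (simp add: prod_eq_iff eq_neg_iff_add_eq_0)
  qed
  moreover have "\<sigma> p = 1 \<or> \<sigma> p = -1" if p: "p \<in> saucer_space" for p
  proof -
    \<comment> \<open>On a nonzero vector of the first factor \<open>K\<close> applied twice is
      multiplication by \<open>\<sigma> p * \<sigma> p\<close>.\<close>
    obtain a where a: "a \<noteq> 0" "snd p \<bullet> a = 0"
      using orthogonal_to_vector_exists[of "snd p"] by (auto simp: orthogonal_def)
    then have X: "(a, 0) \<in> ?D p"
      using p by (simp add: ker_dist_saucer)
    have "K p (a, 0) \<in> ?D p" "K p (K p (a, 0)) = (a, 0)"
      using K p X by blast+
    then have "(\<sigma> p * \<sigma> p) *\<^sub>R a = 1 *\<^sub>R a"
      using K_eq[OF p X] K_eq[OF p \<open>K p (a, 0) \<in> ?D p\<close>] by simp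
    then have "\<sigma> p * \<sigma> p = 1"
      using a(1) scaleR_right_imp_eq by blast
    then show ?thesis
      by (simp add: square_eq_1_iff)
  qed
  ultimately show ?thesis
    using that by blast
qed

text \<open>\<open>K\<close> is \<open>c\<close> on the first factor and \<open>- c\<close> on the
  second. Naming the eigenvalues \<open>c\<close> and \<open>- c\<close> rather than 1 and -1 treats
  both signs at once.\<close>

lemma eigenspaces_saucer:
  assumes p: "p \<in> saucer_space" and "c = 1 \<or> c = -1"
    and K: "\<And>X. X \<in> ker_dist saucer_space saucer_form p \<Longrightarrow> K X = (c *\<^sub>R fst X, - c *\<^sub>R snd X)"
  shows "eigenspace_in (ker_dist saucer_space saucer_form p) K c = (\<lambda>x. (x, 0)) ` {x. snd p \<bullet> x = 0}"
    "eigenspace_in (ker_dist saucer_space saucer_form p) K (- c) = (\<lambda>x. (0, x)) ` {x. snd p \<bullet> x = 0}"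
proof -
  have neg: "- x = x \<longleftrightarrow> x = 0" "x = - x \<longleftrightarrow> x = 0" for x :: "real^3"
    by (metis add.inverse_neutral add_eq_0_iff scaleR_2 scaleR_eq_0_iff zero_neq_numeral)+
  show "eigenspace_in (ker_dist saucer_space saucer_form p) K c = (\<lambda>x. (x, 0)) ` {x. snd p \<bullet> x = 0}"
    using assms(2) by (auto simp: eigenspace_in_def K ker_dist_saucer[OF p] neg image_iff prod_eq_iff)
  show "eigenspace_in (ker_dist saucer_space saucer_form p) K (- c) = (\<lambda>x. (0, x)) ` {x. snd p \<bullet> x = 0}"
    using assms(2) by (auto simp: eigenspace_in_def K ker_dist_saucer[OF p] neg image_iff prod_eq_iff)
qed

text \<open>The endomorphism with \<open>\<sigma> = 1\<close> works: doubling the metric offsets its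
  1/2, after which pairing \<open>X\<close> with \<open>K Y\<close> is exactly the exterior
  derivative.\<close>

lemma compatible_saucer: "compatible saucer_space saucer_form saucer_metric"
proof -
  let ?D = "ker_dist saucer_space saucer_form"
  let ?K = "\<lambda>(p :: (real^3) \<times> (real^3)) (X :: (real^3) \<times> (real^3)). (fst X, - snd X)"
  have const: "smooth_map saucer_space (\<lambda>p. c)" for c :: real
    by (intro smooth_mapI smooth_on_const) simp
  have "(\<lambda>p X Y. 2 * saucer_metric p X Y) \<in> conformal_metrics saucer_space ?D saucer_metric"
    using const[of 2] by (auto simp: conformal_metrics_def)
  moreover have "ext_deriv saucer_form \<in> conformal_two_forms saucer_space ?D (ext_deriv saucer_form)"
    unfolding conformal_two_forms_def
    by (rule CollectI, rule exI[of _ "\<lambda>p. 1"]) (simp add: const)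
  moreover have "dim (eigenspace_in (?D p) (?K p) 1) = dim (eigenspace_in (?D p) (?K p) (-1))"
    if p: "p \<in> saucer_space" for p
  proof -
    have n: "norm (snd p) = 1"
      using p by (auto simp: saucer_space_def)
    show ?thesis
      using eigenspaces_saucer[OF p, of 1 "?K p"]
        subspace_dim_injective_image(2)[OF linear_inj_factors(1,2) n]
        subspace_dim_injective_image(2)[OF linear_inj_factors(3,4) n] by simp
  qed
  ultimately have "compatible_endomorphism saucer_space saucer_form saucer_metric ?K"
    unfolding compatible_endomorphism_def Let_def
    by (intro bexI ballI conjI)
      (auto simp: ker_dist_saucer linear_within_def saucer_metric_def ext_deriv_saucer inner_commute)
  then show ?thesis
    unfolding compatible_def by blast
qed

text \<open>The values 1 and -1 are at distance 2, so a neighbourhood on which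
  \<open>\<sigma>\<close> stays within 1 of \<open>\<sigma> p\<close> allows only one of
  them.\<close>

lemma continuous_on_sign_locally_constant:
  fixes \<sigma> :: "'a::topological_space \<Rightarrow> real"
  assumes "continuous_on M \<sigma>" "\<And>q. q \<in> M \<Longrightarrow> \<sigma> q = 1 \<or> \<sigma> q = -1" "p \<in> M"
  obtains U where "open U" "p \<in> U" "\<And>q. q \<in> M \<inter> U \<Longrightarrow> \<sigma> q = \<sigma> p"
proof -
  have "\<exists>U. open U \<and> p \<in> U \<and> (\<forall>q\<in>M. q \<in> U \<longrightarrow> \<sigma> q \<in> ball (\<sigma> p) 1)"
    using assms(1,3) unfolding continuous_on_topological by (metis open_ball centre_in_ball zero_less_one)
  then obtain U where U: "open U" "p \<in> U" "\<And>q. q \<in> M \<inter> U \<Longrightarrow> \<bar>\<sigma> p - \<sigma> q\<bar> < 1"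
    by (auto simp: dist_real_def)
  have "\<sigma> q = \<sigma> p" if "q \<in> M \<inter> U" for q
    using U(3)[OF that] assms(2)[of q] assms(2)[OF assms(3)] that by auto
  with U(1,2) show ?thesis
    by (rule that)
qed

text \<open>The sign of \<open>K\<close> only decides which factor is which eigenspace, and each
  factor is isotropic because the exterior derivative pairs the first factor only with the
  second.\<close>

lemma legendrean_contact_structure_saucer:
  assumes "compatible_endomorphism saucer_space saucer_form saucer_metric K"
  shows "legendrean_contact_structure 2 saucer_space saucer_form
      (\<lambda>p. eigenspace_in (ker_dist saucer_space saucer_form p) (K p) 1)
      (\<lambda>p. eigenspace_in (ker_dist saucer_space saucer_form p) (K p) (-1))"
proof -
  let ?D = "ker_dist saucer_space saucer_form"
  let ?E = "\<lambda>c p. eigenspace_in (?D p) (K p) c"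
  let ?R = "\<lambda>p. (\<lambda>x. (x, 0)) ` {x. snd p \<bullet> x = 0} :: ((real^3) \<times> (real^3)) set"
  let ?N = "\<lambda>p. (\<lambda>x. (0, x)) ` {x. snd p \<bullet> x = 0} :: ((real^3) \<times> (real^3)) set"
  obtain \<sigma> where \<sigma>: "continuous_on saucer_space \<sigma>"
    "\<And>p. p \<in> saucer_space \<Longrightarrow> \<sigma> p = 1 \<or> \<sigma> p = -1"
    "\<And>p X. p \<in> saucer_space \<Longrightarrow> X \<in> ?D p \<Longrightarrow> K p X = (\<sigma> p *\<^sub>R fst X, - \<sigma> p *\<^sub>R snd X)"
    using compatible_endomorphism_saucerE[OF assms] by metis
  have E: "?E (\<sigma> p) p = ?R p" "?E (- \<sigma> p) p = ?N p" if p: "p \<in> saucer_space" for p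
    by (rule eigenspaces_saucer[OF p \<sigma>(2)[OF p]]; use \<sigma>(3)[OF p] in simp)+
  have R: "smooth_subbundle 2 saucer_space ?R" and N: "smooth_subbundle 2 saucer_space ?N"
    by (rule smooth_subbundle_saucer; simp add: linear_inj_factors)+
  have E_cases: "?E c p = (if c = \<sigma> p then ?R p else ?N p)"
    if "p \<in> saucer_space" "c = 1 \<or> c = -1" for c p
    using E[OF that(1)] \<sigma>(2)[OF that(1)] that(2) by auto
  have subbundle: "smooth_subbundle 2 saucer_space (?E c)" if c: "c = 1 \<or> c = -1" for c
  proof (rule smooth_subbundle_local)
    fix p assume p: "p \<in> saucer_space"
    obtain U where U: "open U" "p \<in> U" "\<And>q. q \<in> saucer_space \<inter> U \<Longrightarrow> \<sigma> q = \<sigma> p"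
      using continuous_on_sign_locally_constant[OF \<sigma>(1,2) p] by metis
    \<comment> \<open>Freezing the sign at its value in \<open>p\<close> gives a bundle on the whole
      space that agrees with the eigenbundle on \<open>U\<close>.\<close>
    let ?F = "if c = \<sigma> p then ?R else ?N"
    have "?E c q = ?F q" if "q \<in> saucer_space \<inter> U" for q
      using E_cases[of q c] U(3)[OF that] that c by simp
    moreover have "smooth_subbundle 2 saucer_space ?F"
      using R N by simp
    ultimately show "\<exists>U E'. open U \<and> p \<in> U \<and> smooth_subbundle 2 saucer_space E' \<and>
        (\<forall>q\<in>saucer_space \<inter> U. ?E c q = E' q)"
      using U(1,2) by (intro exI[of _ U] exI[of _ ?F]) simp
  qed
  have RN: "?D p = {X + Y | X Y. X \<in> ?R p \<and> Y \<in> ?N p}" if "p \<in> saucer_space" for p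
  proof (intro equalityI subsetI)
    fix X assume "X \<in> ?D p"
    then have "(fst X, 0) \<in> ?R p" "(0, snd X) \<in> ?N p" "X = (fst X, 0) + (0, snd X)"
      using that by (auto simp: ker_dist_saucer)
    then show "X \<in> {X + Y | X Y. X \<in> ?R p \<and> Y \<in> ?N p}"
      by blast
  qed (use that in \<open>auto simp: ker_dist_saucer\<close>)
  \<comment> \<open>The sign decides which factor comes first in the decomposition, so both orders
    are provided.\<close>
  have sum_commute: "{X + Y | X Y. X \<in> A \<and> Y \<in> B} = {X + Y | X Y. X \<in> B \<and> Y \<in> A}"
    for A B :: "((real^3) \<times> (real^3)) set"
    by (rule Collect_cong) (metis add.commute)
  have NR: "?D p = {X + Y | X Y. X \<in> ?N p \<and> Y \<in> ?R p}" if "p \<in> saucer_space" for p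
    by (rule trans[OF RN[OF that] sum_commute])
  have "?D p = {X + Y | X Y. X \<in> ?E 1 p \<and> Y \<in> ?E (-1) p} \<and> ?E 1 p \<inter> ?E (-1) p = {0} \<and>
      (\<forall>X\<in>?E 1 p. \<forall>Y\<in>?E 1 p. ext_deriv saucer_form p X Y = 0) \<and>
      (\<forall>X\<in>?E (-1) p. \<forall>Y\<in>?E (-1) p. ext_deriv saucer_form p X Y = 0)"
    if p: "p \<in> saucer_space" for p
  proof -
    have "?R p \<inter> ?N p = {0}"
      by (auto simp: zero_prod_def image_iff)
    moreover have "ext_deriv saucer_form p X Y = 0"
      if "X \<in> ?R p \<and> Y \<in> ?R p \<or> X \<in> ?N p \<and> Y \<in> ?N p" for X Y
      using that by (auto simp: ext_deriv_saucer)
    moreover have "?E 1 p = ?R p \<and> ?E (-1) p = ?N p \<or> ?E 1 p = ?N p \<and> ?E (-1) p = ?R p"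
      using E[OF p] \<sigma>(2)[OF p] by auto
    ultimately show ?thesis
      using RN[OF p] NR[OF p] by (elim disjE conjE) (simp_all add: Int_commute)
  qed
  then show ?thesis
    using contact_form_saucer subbundle by (simp add: legendrean_contact_structure_def)
qed

section \<open>Attacking mode curves\<close>

text \<open>Lagrange's identity leaves only the term \<open>(v \<bullet> w) *\<^sub>R n\<close>.
  This includes the degenerate cases where \<open>v\<close> or \<open>cross3 n w\<close> is
  zero.\<close>

lemma cross3_cross3_eq_0_iff:
  assumes "n \<noteq> 0" "n \<bullet> v = 0"
  shows "cross3 v (cross3 n w) = 0 \<longleftrightarrow> v \<bullet> w = 0"
  using assms by (simp add: Lagrange inner_commute)

lemma velocity_saucer_curve:
  assumes "curve_in saucer_space I (\<lambda>t. (r t, n t))" "t \<in> I"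
  shows "velocity I (\<lambda>t. (r t, n t)) t = (velocity I r t, velocity I n t)"
    "n t \<bullet> velocity I n t = 0"
proof -
  obtain a b where I: "is_interval I" "a \<in> I" "b \<in> I" "a < b"
    using assms(1) by (auto simp: curve_in_def)
  \<comment> \<open>A nondegenerate interval has no isolated points, so derivatives within it are
    unique, endpoints included, and can be compared componentwise.\<close>
  then have "t islimpt I"
    using assms(2) by (intro connected_imp_perfect is_interval_connected) auto
  then have bot: "at t within I \<noteq> bot"
    by (simp add: trivial_limit_within)
  define v w where "v = fst (velocity I (\<lambda>t. (r t, n t)) t)"
    and "w = snd (velocity I (\<lambda>t. (r t, n t)) t)"
  have "(\<lambda>t. (r t, n t)) differentiable (at t within I)"
    using assms by (simp add: curve_in_def differentiable_on_def)
  then have d: "((\<lambda>t. (r t, n t)) has_vector_derivative (v, w)) (at t within I)"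
    by (simp add: v_def w_def velocity_def flip: vector_derivative_works)
  have r: "(r has_vector_derivative v) (at t within I)"
    using bounded_linear.has_vector_derivative[OF bounded_linear_fst d] by simp
  have n: "(n has_vector_derivative w) (at t within I)"
    using bounded_linear.has_vector_derivative[OF bounded_linear_snd d] by simp
  show "velocity I (\<lambda>t. (r t, n t)) t = (velocity I r t, velocity I n t)"
    unfolding velocity_def
    by (simp add: vector_derivative_within[OF bot d] vector_derivative_within[OF bot r]
        vector_derivative_within[OF bot n])
  have "norm (n s) = 1" if "s \<in> I" for s
    using assms(1) that by (auto simp: curve_in_def saucer_space_def)
  then have "n t \<bullet> w = 0"
    by (rule has_vector_derivative_unit_orthogonal[OF n bot assms(2)])
  then show "n t \<bullet> velocity I n t = 0"
    by (simp add: velocity_def vector_derivative_within[OF bot n])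
qed

text \<open>The metric \<open>g\<close> lies in its own class with factor 1. Every other member is a
  multiple of \<open>g\<close> on the fibres, and tangency puts the velocity there.\<close>

lemma null_curve_iff:
  assumes "tangent_to D I \<gamma>" "\<gamma> ` I \<subseteq> M"
  shows "null_curve M D g I \<gamma> \<longleftrightarrow> (\<forall>t\<in>I. g (\<gamma> t) (velocity I \<gamma> t) (velocity I \<gamma> t) = 0)"
proof
  have "smooth_map M (\<lambda>p. 1 :: real)"
    by (intro smooth_mapI smooth_on_const) simp
  then have "g \<in> conformal_metrics M D g"
    unfolding conformal_metrics_def by (intro CollectI exI[of _ "\<lambda>p. 1"]) simp
  then show "null_curve M D g I \<gamma> \<Longrightarrow> \<forall>t\<in>I. g (\<gamma> t) (velocity I \<gamma> t) (velocity I \<gamma> t) = 0"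
    unfolding null_curve_def by blast
  show "\<forall>t\<in>I. g (\<gamma> t) (velocity I \<gamma> t) (velocity I \<gamma> t) = 0 \<Longrightarrow> null_curve M D g I \<gamma>"
    using assms by (auto simp: null_curve_def conformal_metrics_def tangent_to_def image_subset_iff)
qed

lemma attacking_mode_iff_null:
  assumes c: "curve_in saucer_space I (\<lambda>t. (r t, n t))"
  shows "attacking_mode I r n \<longleftrightarrow>
    tangent_to (ker_dist saucer_space saucer_form) I (\<lambda>t. (r t, n t)) \<and>
    null_curve saucer_space (ker_dist saucer_space saucer_form) saucer_metric I (\<lambda>t. (r t, n t))"
proof -
  let ?D = "ker_dist saucer_space saucer_form" and ?\<gamma> = "\<lambda>t. (r t, n t)"
  have M: "?\<gamma> ` I \<subseteq> saucer_space"
    using c by (simp add: curve_in_def)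
  \<comment> \<open>The sphere constraint already makes the velocity of \<open>n\<close> orthogonal
    to \<open>n\<close>, so only the condition on \<open>r\<close> remains.\<close>
  have tangent: "tangent_to ?D I ?\<gamma> \<longleftrightarrow> (\<forall>t\<in>I. n t \<bullet> velocity I r t = 0)"
    using M velocity_saucer_curve[OF c] by (auto simp: tangent_to_def ker_dist_saucer image_subset_iff)
  have null: "saucer_metric (?\<gamma> t) (velocity I ?\<gamma> t) (velocity I ?\<gamma> t) = velocity I r t \<bullet> velocity I n t"
    if "t \<in> I" for t
    using velocity_saucer_curve(1)[OF c that] by (simp add: saucer_metric_def)
  have "n t \<noteq> 0" if "t \<in> I" for t
    using M that by (force simp: saucer_space_def)
  then have "attacking_mode I r n \<longleftrightarrow>
      (\<forall>t\<in>I. n t \<bullet> velocity I r t = 0) \<and> (\<forall>t\<in>I. velocity I r t \<bullet> velocity I n t = 0)"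
    unfolding attacking_mode_def by (metis cross3_cross3_eq_0_iff)
  also have "\<dots> \<longleftrightarrow> tangent_to ?D I ?\<gamma> \<and> null_curve saucer_space ?D saucer_metric I ?\<gamma>"
    using tangent null null_curve_iff[OF _ M, of ?D saucer_metric] by auto
  finally show ?thesis .
qed

theorem proposition2p4:
  shows "metric_of_signature saucer_space (ker_dist saucer_space saucer_form) saucer_metric 2 2 \<and>
    compatible saucer_space saucer_form saucer_metric \<and>
    legendrean_contact_metric_structure 2 saucer_space saucer_form saucer_metric \<and>
    (\<forall>(I :: real set) (r :: real \<Rightarrow> real^3) (n :: real \<Rightarrow> real^3).
       curve_in saucer_space I (\<lambda>t. (r t, n t)) \<longrightarrow>
       (attacking_mode I r n \<longleftrightarrow>
          tangent_to (ker_dist saucer_space saucer_form) I (\<lambda>t. (r t, n t)) \<and>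
          null_curve saucer_space (ker_dist saucer_space saucer_form) saucer_metric I
            (\<lambda>t. (r t, n t))))"
  unfolding legendrean_contact_metric_structure_def
  by (intro conjI allI impI metric_of_signature_saucer compatible_saucer contact_form_saucer
      legendrean_contact_structure_saucer attacking_mode_iff_null)

end
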